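(* Let $N$ be a finite set of positive integers and let $\sigma$ be a partition of $N$ (into nonempty pairwise disjoint blocks). Then $$AMT(N)=\{\emptyset\}\cup\bigcup_{(\kappa_S)_{S\in\sigma}}\Big[\bigvee\{\kappa_S\mid S\in\sigma\},\ \times\{\kappa_S\mid S\in\sigma\}\Big],$$ where the union is taken over all families of antimonotonic functions $(\kappa_S)_{S\in\sigma}$ with $\kappa_S\in AMT(S)\setminus\{\emptyset\}$ for each $S\in\sigma$.
   Context: For a finite set $N$ of positive integers, an antimonotonic function on $2^N$ is a boolean function on $2^N$, identified with the set $\alpha$ of subsets of $N$ on which it is true, such that no element of $\alpha$ is a proper subset of another element of $\alpha$. $AMT(N)$ is the set of all of them (both $\emptyset$ and $\{\emptyset\}$ belong to it). Order: $\alpha\le\beta$ iff every $A\in\alpha$ is contained in some $B\in\beta$. The interval $[\alpha,\beta]$ is $\{\kappa\in AMT(N): \alpha\le\kappa\le\beta\}$. For a family $\mathcal{S}$ of sets, $\sup(\mathcal{S})$ is the set of inclusion-maximal members of $\mathcal{S}$. The span is $sp(\alpha)=\bigcup_{A\in\alpha}A$. Join: $\alpha\vee\beta=\sup(\alpha\cup\beta)$. External product: $\alpha\times\beta=\sup\{(A\setminus sp(\beta))\cup(B\setminus sp(\alpha))\cup(A\cap B)\mid A\in\alpha,\,B\in\beta\}$; for $\alpha,\beta\neq\emptyset$ this is the largest $\kappa\in AMT(N)$ with $sp(\kappa)=sp(\alpha)\cup sp(\beta)$, $\sup\{K\cap sp(\alpha)\mid K\in\kappa\}\le\alpha$ and $\sup\{K\cap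 sp(\beta)\mid K\in\kappa\}\le\beta$. Both operations are associative and commutative; $\bigvee\{\alpha_1,\dots,\alpha_k\}=\alpha_1\vee\dots\vee\alpha_k$ and $\times\{\alpha_1,\dots,\alpha_k\}=\alpha_1\times\dots\times\alpha_k$ (indexed families). By convention both operations applied to an empty family give $\{\emptyset\}$. *)

theory Defs
  imports Main "HOL-Library.Disjoint_Sets" "HOL-Library.FuncSet" "HOL-Library.Multiset"
begin

text \<open>
  A boolean function on the subsets of a set is represented by the family of sets on which it is
  true.
\<close>

definition AMT :: "nat set \<Rightarrow> nat set set set" where
  "AMT N = {\<alpha>. \<alpha> \<subseteq> Pow N \<and> (\<forall>A\<in>\<alpha>. \<forall>B\<in>\<alpha>. \<not> A \<subset> B)}"

definition amf_le :: "nat set set \<Rightarrow> nat set set \<Rightarrow> bool" (infix "\<preceq>" 50) where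
  "\<alpha> \<preceq> \<beta> \<longleftrightarrow> (\<forall>A\<in>\<alpha>. \<exists>B\<in>\<beta>. A \<subseteq> B)"

definition amf_interval :: "nat set \<Rightarrow> nat set set \<Rightarrow> nat set set \<Rightarrow> nat set set set" where
  "amf_interval N \<alpha> \<beta> = {\<kappa> \<in> AMT N. \<alpha> \<preceq> \<kappa> \<and> \<kappa> \<preceq> \<beta>}"

definition maximal_sets :: "nat set set \<Rightarrow> nat set set" where
  "maximal_sets \<S> = {A \<in> \<S>. \<forall>B\<in>\<S>. \<not> A \<subset> B}"

definition sp :: "nat set set \<Rightarrow> nat set" where
  "sp \<alpha> = \<Union>\<alpha>"

definition amf_join :: "nat set set \<Rightarrow> nat set set \<Rightarrow> nat set set" where
  "amf_join \<alpha> \<beta> = maximal_sets (\<alpha> \<union> \<beta>)"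

definition ext_prod :: "nat set set \<Rightarrow> nat set set \<Rightarrow> nat set set" where
  "ext_prod \<alpha> \<beta> =
     maximal_sets {(A - sp \<beta>) \<union> (B - sp \<alpha>) \<union> (A \<inter> B) | A B. A \<in> \<alpha> \<and> B \<in> \<beta>}"

text \<open>
  The iterated operations start from the last member rather than from a neutral element:
  the value \<open>{{}}\<close> is only the convention for the empty family (for instance it is not neutral
  for the join with the empty antichain).
\<close>

fun iterate :: "(nat set set \<Rightarrow> nat set set \<Rightarrow> nat set set) \<Rightarrow> nat set set list \<Rightarrow> nat set set"
where
  "iterate f [] = {{}}"
| "iterate f [\<alpha>] = \<alpha>"
| "iterate f (\<alpha> # \<beta> # \<alpha>s) = f \<alpha> (iterate f (\<beta> # \<alpha>s))"

text \<open>
  For a family indexed by a finite set, the members are combined along some enumeration of the index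
  set. For families of antimonotonic functions the choice is immaterial; see
  \<open>big_join_eq\<close> and \<open>big_prod_eq\<close> below.
\<close>

definition enumeration :: "'i set \<Rightarrow> 'i list" where
  "enumeration I = (SOME xs. distinct xs \<and> set xs = I)"

definition big_join :: "('i \<Rightarrow> nat set set) \<Rightarrow> 'i set \<Rightarrow> nat set set" where
  "big_join \<kappa> I = iterate amf_join (map \<kappa> (enumeration I))"

definition big_prod :: "('i \<Rightarrow> nat set set) \<Rightarrow> 'i set \<Rightarrow> nat set set" where
  "big_prod \<kappa> I = iterate ext_prod (map \<kappa> (enumeration I))"


lemma iterate_Cons: "xs \<noteq> [] \<Longrightarrow> iterate f (x # xs) = f x (iterate f xs)"
  by (cases xs) auto

lemma iterate_perm:
  assumes closed: "\<And>x y. x \<in> C \<Longrightarrow> y \<in> C \<Longrightarrow> f x y \<in> C"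
    and comm: "\<And>x y. x \<in> C \<Longrightarrow> y \<in> C \<Longrightarrow> f x y = f y x"
    and assoc: "\<And>x y z. x \<in> C \<Longrightarrow> y \<in> C \<Longrightarrow> z \<in> C \<Longrightarrow> f (f x y) z = f x (f y z)"
    and "set xs \<subseteq> C" "mset xs = mset ys"
  shows "iterate f xs = iterate f ys"
proof -
  have mem: "iterate f zs \<in> C" if "zs \<noteq> []" "set zs \<subseteq> C" for zs
    using that
  proof (induction zs)
    case (Cons z zs)
    then show ?case by (cases "zs = []") (auto simp: iterate_Cons closed)
  qed simp
  have move: "iterate f (us @ y # vs) = iterate f (y # us @ vs)"
    if "set us \<subseteq> C" "y \<in> C" "set vs \<subseteq> C" for us y vs
    using that
  proof (induction us)
    case (Cons u us)
    show ?case
    proof (cases "us @ vs = []")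
      case True
      then show ?thesis using Cons.prems comm by simp
    next
      case False
      have w: "iterate f (us @ vs) \<in> C" using False Cons.prems by (intro mem) auto
      have "iterate f ((u # us) @ y # vs) = f u (f y (iterate f (us @ vs)))"
        using Cons False by (simp add: iterate_Cons)
      also have "\<dots> = f (f u y) (iterate f (us @ vs))"
        using Cons.prems w by (simp add: assoc)
      also have "\<dots> = f y (f u (iterate f (us @ vs)))"
        using Cons.prems w assoc[of y u] comm[of u y] by simp
      also have "\<dots> = iterate f (y # (u # us) @ vs)"
        using False by (simp add: iterate_Cons)
      finally show ?thesis .
    qed
  qed simp
  show ?thesis
    using assms(4,5)
  proof (induction xs arbitrary: ys)
    case (Cons x xs)
    have "x \<in> set ys" using Cons.prems(2) by (metis list.set_intros(1) set_mset_mset)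
    then obtain us vs where ys: "ys = us @ x # vs" by (meson split_list)
    have ms: "mset xs = mset (us @ vs)" using Cons.prems(2) ys by simp
    have sub: "set us \<subseteq> C" "set vs \<subseteq> C" "x \<in> C"
      using Cons.prems(1) arg_cong[OF ms, of set_mset] by auto
    have IH: "iterate f xs = iterate f (us @ vs)" using Cons.IH Cons.prems(1) ms by simp
    have "iterate f ys = iterate f (x # us @ vs)" using move sub ys by simp
    also have "\<dots> = iterate f (x # xs)"
    proof (cases "xs = []")
      case True
      then show ?thesis using ms by simp
    next
      case False
      then have "us @ vs \<noteq> []" using ms by auto
      then show ?thesis
        using iterate_Cons[OF False, of f x] iterate_Cons[of "us @ vs" f x] IH by simp
    qed
    finally show ?case by simp
  qed simp
qed

lemma maximal_above:
  assumes "finite X" "A \<in> X"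
  obtains M where "M \<in> maximal_sets X" "A \<subseteq> M"
  using finite_has_maximal2[OF assms] unfolding maximal_sets_def
  by (smt (verit, best) mem_Collect_eq psubset_eq)

lemma maximal_subsetI:
  assumes "\<And>A. A \<in> X \<Longrightarrow> \<exists>B\<in>Y. A \<subseteq> B" "\<And>B. B \<in> Y \<Longrightarrow> \<exists>A\<in>X. B \<subseteq> A"
  shows "maximal_sets X \<subseteq> maximal_sets Y"
proof
  fix A assume "A \<in> maximal_sets X"
  then have A: "A \<in> X" "\<And>B. B \<in> X \<Longrightarrow> \<not> A \<subset> B" by (auto simp: maximal_sets_def)
  have *: "B = A" if B: "B \<in> Y" "A \<subseteq> B" for B
  proof -
    obtain C where "C \<in> X" "B \<subseteq> C" using assms(2) B by blast
    then show ?thesis using A(2)[of C] B by blast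
  qed
  obtain B where "B \<in> Y" "A \<subseteq> B" using assms(1) A by blast
  then show "A \<in> maximal_sets Y" using * unfolding maximal_sets_def by blast
qed

lemma maximal_eqI:
  assumes "\<And>A. A \<in> X \<Longrightarrow> \<exists>B\<in>Y. A \<subseteq> B" "\<And>B. B \<in> Y \<Longrightarrow> \<exists>A\<in>X. B \<subseteq> A"
  shows "maximal_sets X = maximal_sets Y"
  using maximal_subsetI[of X Y] maximal_subsetI[of Y X] assms by blast

lemma sp_maximal:
  assumes "finite X"
  shows "sp (maximal_sets X) = sp X"
proof
  show "sp (maximal_sets X) \<subseteq> sp X" by (auto simp: sp_def maximal_sets_def)
next
  show "sp X \<subseteq> sp (maximal_sets X)"
  proof
    fix x assume "x \<in> sp X"
    then obtain A where "A \<in> X" "x \<in> A" by (auto simp: sp_def)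
    moreover obtain M where "M \<in> maximal_sets X" "A \<subseteq> M"
      using maximal_above[OF assms \<open>A \<in> X\<close>] .
    ultimately show "x \<in> sp (maximal_sets X)" by (auto simp: sp_def)
  qed
qed

lemma maximal_AMT: "X \<subseteq> Pow N \<Longrightarrow> maximal_sets X \<in> AMT N"
  unfolding AMT_def maximal_sets_def by auto

lemma AMT_D: "\<alpha> \<in> AMT N \<Longrightarrow> \<alpha> \<subseteq> Pow N"
  by (simp add: AMT_def)

lemma AMT_finite: "finite N \<Longrightarrow> \<alpha> \<in> AMT N \<Longrightarrow> finite \<alpha>"
  by (meson AMT_D finite_Pow_iff finite_subset)

lemma amf_join_AMT: "\<alpha> \<in> AMT N \<Longrightarrow> \<beta> \<in> AMT N \<Longrightarrow> amf_join \<alpha> \<beta> \<in> AMT N"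
  unfolding amf_join_def using maximal_AMT[of "\<alpha> \<union> \<beta>" N] AMT_D by blast

lemma amf_join_commute: "amf_join \<alpha> \<beta> = amf_join \<beta> \<alpha>"
  by (simp add: amf_join_def Un_commute)

lemma maximal_Un_maximal:
  assumes "finite X"
  shows "maximal_sets (maximal_sets X \<union> Y) = maximal_sets (X \<union> Y)"
proof (rule maximal_eqI)
  fix A assume "A \<in> maximal_sets X \<union> Y"
  then show "\<exists>B\<in>X \<union> Y. A \<subseteq> B" by (auto simp: maximal_sets_def)
next
  fix A assume "A \<in> X \<union> Y"
  then show "\<exists>B\<in>maximal_sets X \<union> Y. A \<subseteq> B"
    using maximal_above[OF assms] by (metis Un_iff order_refl)
qed

lemma amf_join_assoc:
  assumes "finite \<alpha>" "finite \<beta>" "finite \<gamma>"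
  shows "amf_join (amf_join \<alpha> \<beta>) \<gamma> = amf_join \<alpha> (amf_join \<beta> \<gamma>)"
  using maximal_Un_maximal[of "\<alpha> \<union> \<beta>" \<gamma>] maximal_Un_maximal[of "\<beta> \<union> \<gamma>" \<alpha>] assms
  by (simp add: amf_join_def Un_ac)

definition comb :: "nat set \<Rightarrow> nat set \<Rightarrow> nat set \<Rightarrow> nat set \<Rightarrow> nat set" where
  "comb a b A B = (A - b) \<union> (B - a) \<union> (A \<inter> B)"

definition raw_prod :: "nat set set \<Rightarrow> nat set set \<Rightarrow> nat set set" where
  "raw_prod \<alpha> \<beta> = (\<lambda>(A, B). comb (sp \<alpha>) (sp \<beta>) A B) ` (\<alpha> \<times> \<beta>)"

lemma ext_prod_raw: "ext_prod \<alpha> \<beta> = maximal_sets (raw_prod \<alpha> \<beta>)"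
  unfolding ext_prod_def raw_prod_def comb_def by (rule arg_cong[of _ _ maximal_sets]) auto

lemma comb_mono: "A \<subseteq> A' \<Longrightarrow> comb a b A B \<subseteq> comb a b A' B"
  by (auto simp: comb_def)

lemma sp_raw: "\<alpha> \<noteq> {} \<Longrightarrow> \<beta> \<noteq> {} \<Longrightarrow> sp (raw_prod \<alpha> \<beta>) = sp \<alpha> \<union> sp \<beta>"
  unfolding raw_prod_def comb_def sp_def by (auto; blast)

lemma ext_prod_AMT: "\<alpha> \<in> AMT N \<Longrightarrow> \<beta> \<in> AMT N \<Longrightarrow> ext_prod \<alpha> \<beta> \<in> AMT N"
  unfolding ext_prod_def by (rule maximal_AMT) (auto dest!: AMT_D)

lemma ext_prod_commute: "ext_prod \<alpha> \<beta> = ext_prod \<beta> \<alpha>"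
  unfolding ext_prod_def by (rule arg_cong[of _ _ maximal_sets]) blast

lemma ext_prod_triple:
  assumes "finite \<alpha>" "finite \<beta>" "\<alpha> \<noteq> {}" "\<beta> \<noteq> {}"
  shows "ext_prod (ext_prod \<alpha> \<beta>) \<gamma> =
    maximal_sets {comb (sp \<alpha> \<union> sp \<beta>) (sp \<gamma>) (comb (sp \<alpha>) (sp \<beta>) A B) C | A B C.
      A \<in> \<alpha> \<and> B \<in> \<beta> \<and> C \<in> \<gamma>}"
proof -
  have fin: "finite (raw_prod \<alpha> \<beta>)" using assms by (simp add: raw_prod_def)
  have s: "sp (ext_prod \<alpha> \<beta>) = sp \<alpha> \<union> sp \<beta>"
    using assms fin by (simp add: ext_prod_raw sp_maximal sp_raw)
  show ?thesis
    unfolding ext_prod_raw[of _ \<gamma>] raw_prod_def[of _ \<gamma>] s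
  proof (rule maximal_eqI, goal_cases)
    case (1 X)
    then show ?case
      by (fastforce simp: ext_prod_raw maximal_sets_def raw_prod_def)
  next
    case (2 X)
    then obtain A B C where X: "A \<in> \<alpha>" "B \<in> \<beta>" "C \<in> \<gamma>"
      "X = comb (sp \<alpha> \<union> sp \<beta>) (sp \<gamma>) (comb (sp \<alpha>) (sp \<beta>) A B) C" by blast
    then have "comb (sp \<alpha>) (sp \<beta>) A B \<in> raw_prod \<alpha> \<beta>" by (auto simp: raw_prod_def)
    then obtain P where "P \<in> ext_prod \<alpha> \<beta>" "comb (sp \<alpha>) (sp \<beta>) A B \<subseteq> P"
      using maximal_above[OF fin] by (metis ext_prod_raw)
    then have "X \<subseteq> comb (sp \<alpha> \<union> sp \<beta>) (sp \<gamma>) P C"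
        "comb (sp \<alpha> \<union> sp \<beta>) (sp \<gamma>) P C \<in>
          (\<lambda>(A, B). comb (sp \<alpha> \<union> sp \<beta>) (sp \<gamma>) A B) ` (ext_prod \<alpha> \<beta> \<times> \<gamma>)"
      using X comb_mono by auto
    then show ?case by (rule rev_bexI[rotated])
  qed
qed

lemma ext_prod_empty [simp]: "ext_prod {} \<beta> = {}" "ext_prod \<alpha> {} = {}"
  by (auto simp: ext_prod_def maximal_sets_def)

lemma ext_prod_assoc:
  assumes "finite \<alpha>" "finite \<beta>" "finite \<gamma>"
  shows "ext_prod (ext_prod \<alpha> \<beta>) \<gamma> = ext_prod \<alpha> (ext_prod \<beta> \<gamma>)"
proof (cases "\<alpha> = {} \<or> \<beta> = {} \<or> \<gamma> = {}")
  case True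
  then show ?thesis by auto
next
  case False
  have rot: "comb (sp \<alpha> \<union> sp \<beta>) (sp \<gamma>) (comb (sp \<alpha>) (sp \<beta>) A B) C =
      comb (sp \<beta> \<union> sp \<gamma>) (sp \<alpha>) (comb (sp \<beta>) (sp \<gamma>) B C) A"
    if "A \<in> \<alpha>" "B \<in> \<beta>" "C \<in> \<gamma>" for A B C
  proof -
    have "A \<subseteq> sp \<alpha>" "B \<subseteq> sp \<beta>" "C \<subseteq> sp \<gamma>" using that by (auto simp: sp_def)
    then show ?thesis unfolding comb_def by blast
  qed
  have "{comb (sp \<alpha> \<union> sp \<beta>) (sp \<gamma>) (comb (sp \<alpha>) (sp \<beta>) A B) C | A B C.
        A \<in> \<alpha> \<and> B \<in> \<beta> \<and> C \<in> \<gamma>} =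
      {comb (sp \<beta> \<union> sp \<gamma>) (sp \<alpha>) (comb (sp \<beta>) (sp \<gamma>) B C) A | B C A.
        B \<in> \<beta> \<and> C \<in> \<gamma> \<and> A \<in> \<alpha>}"
    using rot by (intro Collect_cong) metis
  then have "ext_prod (ext_prod \<alpha> \<beta>) \<gamma> = ext_prod (ext_prod \<beta> \<gamma>) \<alpha>"
    using False assms by (simp add: ext_prod_triple)
  then show ?thesis by (simp add: ext_prod_commute)
qed

lemma mset_map_enumeration:
  assumes "distinct xs" "set xs = I"
  shows "mset (map \<kappa> (enumeration I)) = mset (map \<kappa> xs)" "set (enumeration I) = I"
proof -
  have *: "distinct (enumeration I) \<and> set (enumeration I) = I"
    unfolding enumeration_def by (rule someI[of _ xs]) (use assms in simp)
  then show "set (enumeration I) = I" by simp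
  show "mset (map \<kappa> (enumeration I)) = mset (map \<kappa> xs)"
    using * assms by (metis mset_map set_eq_iff_mset_eq_distinct)
qed

theorem big_join_eq:
  assumes "finite N" "\<kappa> ` I \<subseteq> AMT N" "distinct xs" "set xs = I"
  shows "big_join \<kappa> I = iterate amf_join (map \<kappa> xs)"
  unfolding big_join_def
proof (rule iterate_perm[of "AMT N"])
  show "set (map \<kappa> (enumeration I)) \<subseteq> AMT N"
    using assms(2) mset_map_enumeration(2)[OF assms(3,4)] by simp
  show "mset (map \<kappa> (enumeration I)) = mset (map \<kappa> xs)"
    using mset_map_enumeration(1)[OF assms(3,4)] .
next
  fix \<alpha> \<beta> \<gamma> assume "\<alpha> \<in> AMT N" "\<beta> \<in> AMT N" "\<gamma> \<in> AMT N"
  then show "amf_join (amf_join \<alpha> \<beta>) \<gamma> = amf_join \<alpha> (amf_join \<beta> \<gamma>)"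
    by (intro amf_join_assoc AMT_finite[OF assms(1)])
qed (rule amf_join_AMT amf_join_commute; assumption)+

theorem big_prod_eq:
  assumes "finite N" "\<kappa> ` I \<subseteq> AMT N" "distinct xs" "set xs = I"
  shows "big_prod \<kappa> I = iterate ext_prod (map \<kappa> xs)"
  unfolding big_prod_def
proof (rule iterate_perm[of "AMT N"])
  show "set (map \<kappa> (enumeration I)) \<subseteq> AMT N"
    using assms(2) mset_map_enumeration(2)[OF assms(3,4)] by simp
  show "mset (map \<kappa> (enumeration I)) = mset (map \<kappa> xs)"
    using mset_map_enumeration(1)[OF assms(3,4)] .
next
  fix \<alpha> \<beta> \<gamma> assume "\<alpha> \<in> AMT N" "\<beta> \<in> AMT N" "\<gamma> \<in> AMT N"
  then show "ext_prod (ext_prod \<alpha> \<beta>) \<gamma> = ext_prod \<alpha> (ext_prod \<beta> \<gamma>)"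
    by (intro ext_prod_assoc AMT_finite[OF assms(1)])
qed (rule ext_prod_AMT ext_prod_commute; assumption)+

end

theory Submission
  imports Defs
begin

text \<open>
  A nonempty antichain \<open>\<chi>\<close> on \<open>N\<close> lies in the interval determined by its own
  traces on the blocks: take for \<open>\<kappa>\<^sub>S\<close> the maximal sets among \<open>K \<inter>
  S\<close> with \<open>K \<in> \<chi>\<close>. Over a nonempty partition, every member of the join is a
  single trace \<open>K \<inter> S\<close> and so is contained in \<open>K\<close>
  (\<open>iterate_amf_join_member\<close>), which gives the lower bound; over the empty partition the join is
  \<open>{{}}\<close>, which lies below \<open>\<chi>\<close> because \<open>\<chi> \<noteq> {}\<close>. For
  the upper bound, blocks are disjoint, so the external product amounts to taking unions of one member of each
  factor (\<open>ext_prod_above_Un\<close>, \<open>iterate_ext_prod_above_UN\<close>); and \<open>K\<close> is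
  the union of its traces \<open>K \<inter> S\<close>, each of which extends to a member of
  \<open>\<kappa>\<^sub>S\<close>.
\<close>

lemma AMT_mono: "M \<subseteq> N \<Longrightarrow> AMT M \<subseteq> AMT N"
  unfolding AMT_def by blast

lemma iterate_amf_join_member:
  "A \<in> iterate amf_join \<alpha>s \<Longrightarrow> \<alpha>s \<noteq> [] \<Longrightarrow> \<exists>\<alpha>\<in>set \<alpha>s. A \<in> \<alpha>"
proof (induction \<alpha>s)
  case (Cons \<alpha> \<alpha>s)
  then show ?case
    by (cases "\<alpha>s = []") (auto simp: iterate_Cons amf_join_def maximal_sets_def)
qed simp

text \<open>
  When the spans are disjoint, the set combined from \<open>A\<close> and \<open>B\<close> in the external product is simply
  \<open>A \<union> B\<close>; it may fail to be maximal only in favour of a larger set.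
\<close>

lemma ext_prod_above_Un:
  assumes "finite \<alpha>" "finite \<beta>" "sp \<alpha> \<inter> sp \<beta> = {}" "A \<in> \<alpha>" "B \<in> \<beta>"
  shows "\<exists>P\<in>ext_prod \<alpha> \<beta>. A \<union> B \<subseteq> P"
proof -
  have "A \<subseteq> sp \<alpha>" "B \<subseteq> sp \<beta>" using assms by (auto simp: sp_def)
  then have "A \<union> B = comb (sp \<alpha>) (sp \<beta>) A B" using assms(3) unfolding comb_def by blast
  then have "A \<union> B \<in> raw_prod \<alpha> \<beta>" using assms(4,5) by (auto simp: raw_prod_def)
  moreover have "finite (raw_prod \<alpha> \<beta>)" using assms(1,2) by (simp add: raw_prod_def)
  ultimately show ?thesis unfolding ext_prod_raw by (metis maximal_above)
qed

text \<open>
  The first conclusion bounds the span of the partial product, so that it stays disjoint from the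
  next block and the two-factor case applies.
\<close>

lemma iterate_ext_prod_above_UN:
  assumes "finite (\<Union>(set xs))" "distinct xs" "disjoint (set xs)"
    and "\<And>S. S \<in> set xs \<Longrightarrow> \<kappa> S \<in> AMT S"
  shows "iterate ext_prod (map \<kappa> xs) \<in> AMT (\<Union>(set xs))"
    and "(\<And>S. S \<in> set xs \<Longrightarrow> A S \<in> \<kappa> S) \<Longrightarrow>
      \<exists>P\<in>iterate ext_prod (map \<kappa> xs). (\<Union>S\<in>set xs. A S) \<subseteq> P"
  using assms
proof (induction xs)
  case Nil
  { case 1 show ?case by (simp add: AMT_def) }
  { case 2 show ?case by simp }
next
  case (Cons S xs)
  let ?\<pi> = "iterate ext_prod (map \<kappa> xs)"
  have IH1: "?\<pi> \<in> AMT (\<Union>(set xs))"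
    if "finite (\<Union>(set (S # xs)))" "distinct (S # xs)" "disjoint (set (S # xs))"
      "\<And>T. T \<in> set (S # xs) \<Longrightarrow> \<kappa> T \<in> AMT T"
    using Cons.IH(1) that by (auto simp: pairwise_insert)
  { case 1
    have "?\<pi> \<in> AMT (\<Union>(set (S # xs)))" "\<kappa> S \<in> AMT (\<Union>(set (S # xs)))"
      using IH1[OF 1] 1(4)[of S] AMT_mono[of _ "\<Union>(set (S # xs))"] by force+
    then show ?case by (cases "xs = []") (simp_all add: iterate_Cons ext_prod_AMT) }
  { case 2
    have \<pi>: "?\<pi> \<in> AMT (\<Union>(set xs))" using IH1[OF 2(2-)] .
    have \<kappa>: "\<kappa> S \<in> AMT S" using 2(5) by simp
    have fin: "finite ?\<pi>" "finite (\<kappa> S)"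
      using AMT_finite[OF _ \<pi>] AMT_finite[OF _ \<kappa>] 2(2) by simp_all
    have "S \<inter> \<Union>(set xs) = {}"
      using 2(3,4) by (auto simp: pairwise_insert disjnt_iff)
    then have disj: "sp (\<kappa> S) \<inter> sp ?\<pi> = {}"
      using AMT_D[OF \<pi>] AMT_D[OF \<kappa>] unfolding sp_def by blast
    obtain P where P: "P \<in> ?\<pi>" "(\<Union>T\<in>set xs. A T) \<subseteq> P"
      using Cons.IH(2) 2 by (auto simp: pairwise_insert)
    obtain Q where "Q \<in> ext_prod (\<kappa> S) ?\<pi>" "A S \<union> P \<subseteq> Q"
      using ext_prod_above_Un[OF fin(2,1) disj _ P(1), of "A S"] 2(1)[of S] by auto
    then show ?case
      using P 2(1)[of S] by (cases "xs = []") (auto simp: iterate_Cons) }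
qed

theorem corollary3:
  fixes N :: "nat set" and \<sigma> :: "nat set set"
  assumes "finite N" and "\<forall>n\<in>N. 0 < n" and "partition_on N \<sigma>"
  shows "AMT N = {{}} \<union>
    (\<Union>\<kappa> \<in> (\<Pi>\<^sub>E S\<in>\<sigma>. AMT S - {{}}).
       amf_interval N (big_join \<kappa> \<sigma>) (big_prod \<kappa> \<sigma>))"
proof (intro equalityI subsetI)
  fix \<chi> assume "\<chi> \<in> {{}} \<union> (\<Union>\<kappa> \<in> (\<Pi>\<^sub>E S\<in>\<sigma>. AMT S - {{}}).
       amf_interval N (big_join \<kappa> \<sigma>) (big_prod \<kappa> \<sigma>))"
  then show "\<chi> \<in> AMT N" by (auto simp: amf_interval_def AMT_def)
next
  fix \<chi> assume \<chi>: "\<chi> \<in> AMT N"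
  have N: "N = \<Union>\<sigma>" and disj: "disjoint \<sigma>"
    using assms(3) by (auto simp: partition_on_def)
  have fin\<chi>: "finite \<chi>" using AMT_finite[OF assms(1) \<chi>] .
  obtain xs where xs: "set xs = \<sigma>" "distinct xs"
    using finite_distinct_list[OF finite_elements[OF assms(1,3)]] by blast
  define \<kappa> where "\<kappa> = restrict (\<lambda>S. maximal_sets ((\<lambda>K. K \<inter> S) ` \<chi>)) \<sigma>"
  have \<kappa>_AMT: "\<kappa> S \<in> AMT S" if "S \<in> \<sigma>" for S
    using that unfolding \<kappa>_def by (auto intro: maximal_AMT)
  have trace: "\<exists>A\<in>\<kappa> S. K \<inter> S \<subseteq> A" if "S \<in> \<sigma>" "K \<in> \<chi>" for S K
    using maximal_above[of "(\<lambda>K. K \<inter> S) ` \<chi>" "K \<inter> S"] that fin\<chi> unfolding \<kappa>_def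
    by (metis finite_imageI image_eqI restrict_apply)
  have im: "\<kappa> ` \<sigma> \<subseteq> AMT N" using \<kappa>_AMT AMT_mono N by blast
  note join = big_join_eq[OF assms(1) im xs(2,1)] and prod = big_prod_eq[OF assms(1) im xs(2,1)]
  show "\<chi> \<in> {{}} \<union> (\<Union>\<kappa> \<in> (\<Pi>\<^sub>E S\<in>\<sigma>. AMT S - {{}}).
       amf_interval N (big_join \<kappa> \<sigma>) (big_prod \<kappa> \<sigma>))"
  proof (cases "\<chi> = {}")
    case False
    have "\<kappa> S \<noteq> {}" if "S \<in> \<sigma>" for S
      using trace[OF that] False by blast
    then have "\<kappa> \<in> (\<Pi>\<^sub>E S\<in>\<sigma>. AMT S - {{}})"
      using \<kappa>_AMT by (intro PiE_I) (simp_all add: \<kappa>_def)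
    moreover have "big_join \<kappa> \<sigma> \<preceq> \<chi>"
    proof (cases "\<sigma> = {}")
      case True
      then have "big_join \<kappa> \<sigma> = {{}}" using xs(1) unfolding join by simp
      then show ?thesis using False by (auto simp: amf_le_def)
    next
      case ne: False
      have "\<exists>K\<in>\<chi>. A \<subseteq> K" if A: "A \<in> iterate amf_join (map \<kappa> xs)" for A
      proof -
        have "map \<kappa> xs \<noteq> []" using ne xs(1) by auto
        from iterate_amf_join_member[OF A this] obtain S where "S \<in> \<sigma>" "A \<in> \<kappa> S"
          unfolding set_map xs(1) by blast
        then show ?thesis by (auto simp: \<kappa>_def maximal_sets_def)
      qed
      then show ?thesis by (simp add: join amf_le_def)
    qed
    moreover have "\<chi> \<preceq> big_prod \<kappa> \<sigma>"
      unfolding amf_le_def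
    proof
      fix K assume K: "K \<in> \<chi>"
      have "\<forall>S\<in>\<sigma>. \<exists>A. A \<in> \<kappa> S \<and> K \<inter> S \<subseteq> A" using trace[OF _ K] by blast
      then obtain A where A: "\<And>S. S \<in> \<sigma> \<Longrightarrow> A S \<in> \<kappa> S \<and> K \<inter> S \<subseteq> A S"
        unfolding bchoice_iff by blast
      have "finite (\<Union>(set xs))" "disjoint (set xs)"
        using assms(1) xs(1) disj N by simp_all
      then have "\<exists>P\<in>big_prod \<kappa> \<sigma>. (\<Union>S\<in>set xs. A S) \<subseteq> P"
        unfolding prod using xs \<kappa>_AMT A by (intro iterate_ext_prod_above_UN(2)) simp_all
      then obtain P where "P \<in> big_prod \<kappa> \<sigma>" "(\<Union>S\<in>\<sigma>. A S) \<subseteq> P"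
        unfolding xs(1) by blast
      moreover have "K \<subseteq> (\<Union>S\<in>\<sigma>. A S)"
      proof
        fix x assume "x \<in> K"
        then obtain S where "S \<in> \<sigma>" "x \<in> S" using AMT_D[OF \<chi>] K N by blast
        then show "x \<in> (\<Union>S\<in>\<sigma>. A S)" using A[of S] \<open>x \<in> K\<close> by blast
      qed
      ultimately show "\<exists>P\<in>big_prod \<kappa> \<sigma>. K \<subseteq> P" by (meson subset_trans)
    qed
    ultimately show ?thesis
      using \<chi> unfolding amf_interval_def by (intro UnI2 UN_I CollectI conjI)
  qed simp
qed

end
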